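(* Let $\lambda\in\mathbb R$ and let $\gamma(t)=\Psi(u(t),v(t))$, $t\in[a,b]$, be a smooth non-degenerate curve in $(\mathbb S_1^2)_{y-z}^+=\{(x,y,z)\in\mathbb S_1^2:y-z>0\}$. Let $d_{y-z}(t)$ be the distance of $\gamma(t)$ to the plane $\Pi_{y-z}=\{y-z=0\}$, let $\mathbf n$ be the principal normal vector of $\gamma$, let $T=\partial_y+\partial_z$, and assume $d_{y-z}(t)+\lambda\neq0$ for all $t$. Then $\gamma$ is a catenary with respect to $\Pi_{y-z}$ (with Lagrange multiplier $\lambda$) if and only if its curvature $\kappa$ satisfies $$\kappa(t)=-\frac{\langle\mathbf n(t),T\rangle}{d_{y-z}(t)+\lambda}.$$
   Context: $\mathbb L^3$ is $\mathbb R^3$ with the metric $\langle\,,\rangle=(dx)^2+(dy)^2-(dz)^2$, and $\mathbb S_1^2=\{(x,y,z):x^2+y^2-z^2=1\}$ with the induced metric, parametrized by $\Psi\colon\mathbb R^2\to\mathbb S_1^2$, $\Psi(u,v)=(\cosh(u)\cos v,\cosh(u)\sin v,\sinh(u))$. A curve $\gamma$ is non-degenerate if it is spacelike ($\langle\gamma',\gamma'\rangle>0$ everywhere; $\epsilon=1$) or timelike ($\langle\gamma',\gamma'\rangle<0$ everywhere; $\epsilon=-1$). For $\gamma(t)=\Psi(u(t),v(t))$ one has $|\gamma'|=\sqrt{\epsilon\langle\gamma',\gamma'\rangle}=\sqrt{\epsilon(v'^2\cosh(u)^2-u'^2)}$. With $\xi(p)=-p$ and $\times$ the Lorentzian cross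 product, $\langle a\times b,c\rangle=\det(a,b,c)$, the (geodesic) curvature of $\gamma$ in $\mathbb S_1^2$ is $\kappa=\epsilon\,\dfrac{\langle\gamma'',\gamma'\times\xi(\gamma)\rangle}{|\gamma'|^3}=\epsilon\,\dfrac{\det(\gamma,\gamma',\gamma'')}{|\gamma'|^3}$, and the principal normal vector is $\mathbf n=\dfrac{\xi(\gamma)\times\gamma'}{|\gamma'|}=-\dfrac{\gamma\times\gamma'}{|\gamma'|}$. The distance of a point $(x,y,z)\in(\mathbb S_1^2)_{y-z}^+$ to $\Pi_{y-z}$ is taken to be $y-z$ (ignoring a constant factor $\sqrt2$), so $d_{y-z}(t)=\cosh u(t)\sin v(t)-\sinh u(t)$. A catenary with respect to $\Pi_{y-z}$ with Lagrange multiplier $\lambda$ is a critical point, among curves in $(\mathbb S_1^2)_{y-z}^+$ with the same endpoints, of $$\mathcal E_{y-z}[\gamma]=\int_a^b(\cosh(u)\sin(v)-\sinh(u)+\lambda)\sqrt{\epsilon(v'^2\cosh(u)^2-u'^2)}\,dt,$$ i.e. a solution of its Euler-Lagrange equations. *)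

theory Defs
  imports "HOL-Analysis.Analysis"
begin

section \<open>Smooth functions on a closed interval and on a strip\<close>

text \<open>
  Derivatives are taken within the interval, so they are one-sided at its end points.
  The witness \<open>D\<close> lists the successive derivatives.
\<close>

definition smooth_on_interval :: "real set \<Rightarrow> (real \<Rightarrow> real) \<Rightarrow> bool" where
  "smooth_on_interval I f \<longleftrightarrow>
     (\<exists>D :: nat \<Rightarrow> real \<Rightarrow> real.
        (\<forall>t\<in>I. D 0 t = f t) \<and>
        (\<forall>n. \<forall>t\<in>I. (D n has_real_derivative D (Suc n) t) (at t within I)))"

text \<open>
  Here \<open>D i j\<close> is the partial derivative of order \<open>i\<close> in \<open>s\<close> and \<open>j\<close> in \<open>t\<close>; all of them
  exist and are jointly continuous.  For a \<open>C\<^sup>\<infinity>\<close> function they do not depend on the order of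
  differentiation, so a doubly indexed family is enough.
\<close>

definition smooth_on_strip :: "real set \<Rightarrow> real set \<Rightarrow> (real \<Rightarrow> real \<Rightarrow> real) \<Rightarrow> bool" where
  "smooth_on_strip S I F \<longleftrightarrow>
     (\<exists>D :: nat \<Rightarrow> nat \<Rightarrow> real \<Rightarrow> real \<Rightarrow> real.
        (\<forall>s\<in>S. \<forall>t\<in>I. D 0 0 s t = F s t) \<and>
        (\<forall>i j. continuous_on (S \<times> I) (\<lambda>(s, t). D i j s t)) \<and>
        (\<forall>i j. \<forall>s\<in>S. \<forall>t\<in>I.
           ((\<lambda>s'. D i j s' t) has_real_derivative D (Suc i) j s t) (at s within S) \<and>
           ((\<lambda>t'. D i j s t') has_real_derivative D i (Suc j) s t) (at t within I)))"

definition velocity :: "real set \<Rightarrow> (real \<Rightarrow> 'a::real_normed_vector) \<Rightarrow> real \<Rightarrow> 'a" where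
  "velocity I c t = vector_derivative c (at t within I)"

definition acceleration :: "real set \<Rightarrow> (real \<Rightarrow> 'a::real_normed_vector) \<Rightarrow> real \<Rightarrow> 'a" where
  "acceleration I c t = velocity I (velocity I c) t"


section \<open>Lorentz-Minkowski space and the de Sitter surface\<close>

definition lprod :: "real^3 \<Rightarrow> real^3 \<Rightarrow> real" where
  "lprod p q = p $ 1 * q $ 1 + p $ 2 * q $ 2 - p $ 3 * q $ 3"

definition lcross :: "real^3 \<Rightarrow> real^3 \<Rightarrow> real^3" where
  "lcross p q = vector [p $ 2 * q $ 3 - p $ 3 * q $ 2,
                        p $ 3 * q $ 1 - p $ 1 * q $ 3,
                        - (p $ 1 * q $ 2 - p $ 2 * q $ 1)]"

lemma lprod_lcross: "lprod (lcross p q) r = det (vector [p, q, r] :: real^3^3)"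
  by (simp add: lprod_def lcross_def det_3 vector_3 algebra_simps)

definition de_sitter :: "(real^3) set" where
  "de_sitter = {p. (p $ 1)\<^sup>2 + (p $ 2)\<^sup>2 - (p $ 3)\<^sup>2 = 1}"

definition de_sitter_yz_pos :: "(real^3) set" where
  "de_sitter_yz_pos = {p \<in> de_sitter. p $ 2 - p $ 3 > 0}"

definition Psi :: "real \<Rightarrow> real \<Rightarrow> real^3" where
  "Psi u v = vector [cosh u * cos v, cosh u * sin v, sinh u]"

lemma Psi_in_de_sitter: "Psi u v \<in> de_sitter"
proof -
  have "(cosh u * cos v)\<^sup>2 + (cosh u * sin v)\<^sup>2 = (cosh u)\<^sup>2 * ((cos v)\<^sup>2 + (sin v)\<^sup>2)"
    by (simp add: power_mult_distrib algebra_simps del: sin_cos_squared_add sin_cos_squared_add2)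
  then show ?thesis
    by (simp add: de_sitter_def Psi_def vector_3 cosh_square_eq)
qed

definition curve :: "(real \<Rightarrow> real) \<Rightarrow> (real \<Rightarrow> real) \<Rightarrow> real \<Rightarrow> real^3" where
  "curve u v t = Psi (u t) (v t)"


section \<open>Geometry of non-degenerate curves\<close>

definition spacelike :: "real set \<Rightarrow> (real \<Rightarrow> real^3) \<Rightarrow> bool" where
  "spacelike I c \<longleftrightarrow> (\<forall>t\<in>I. lprod (velocity I c t) (velocity I c t) > 0)"

definition timelike :: "real set \<Rightarrow> (real \<Rightarrow> real^3) \<Rightarrow> bool" where
  "timelike I c \<longleftrightarrow> (\<forall>t\<in>I. lprod (velocity I c t) (velocity I c t) < 0)"

definition nondegenerate :: "real \<Rightarrow> real set \<Rightarrow> (real \<Rightarrow> real^3) \<Rightarrow> bool" where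
  "nondegenerate \<epsilon> I c \<longleftrightarrow> (\<epsilon> = 1 \<and> spacelike I c) \<or> (\<epsilon> = - 1 \<and> timelike I c)"

definition speed :: "real \<Rightarrow> real set \<Rightarrow> (real \<Rightarrow> real^3) \<Rightarrow> real \<Rightarrow> real" where
  "speed \<epsilon> I c t = sqrt (\<epsilon> * lprod (velocity I c t) (velocity I c t))"

definition \<xi> :: "real^3 \<Rightarrow> real^3" where
  "\<xi> p = - p"

definition curvature :: "real \<Rightarrow> real set \<Rightarrow> (real \<Rightarrow> real^3) \<Rightarrow> real \<Rightarrow> real" where
  "curvature \<epsilon> I c t =
     \<epsilon> * lprod (acceleration I c t) (lcross (velocity I c t) (\<xi> (c t))) / (speed \<epsilon> I c t) ^ 3"

definition principal_normal :: "real \<Rightarrow> real set \<Rightarrow> (real \<Rightarrow> real^3) \<Rightarrow> real \<Rightarrow> real^3" where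
  "principal_normal \<epsilon> I c t =
     (1 / speed \<epsilon> I c t) *\<^sub>R lcross (\<xi> (c t)) (velocity I c t)"

definition T_yz :: "real^3" where
  "T_yz = vector [0, 1, 1]"

text \<open>The distance to the plane \<open>y = z\<close>, up to the constant factor \<open>\<surd>2\<close>, on the side \<open>y > z\<close>.\<close>

definition dist_yz :: "real^3 \<Rightarrow> real" where
  "dist_yz p = p $ 2 - p $ 3"


section \<open>Catenaries\<close>

definition energy_yz ::
  "real \<Rightarrow> real \<Rightarrow> real \<Rightarrow> real \<Rightarrow> (real \<Rightarrow> real) \<Rightarrow> (real \<Rightarrow> real) \<Rightarrow> real" where
  "energy_yz \<epsilon> lam a b u v =
     integral {a..b} (\<lambda>t.
       (cosh (u t) * sin (v t) - sinh (u t) + lam) *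
       sqrt (\<epsilon> * ((velocity {a..b} v t)\<^sup>2 * (cosh (u t))\<^sup>2 - (velocity {a..b} u t)\<^sup>2)))"

definition admissible_curve ::
  "real \<Rightarrow> real \<Rightarrow> real \<Rightarrow> (real \<Rightarrow> real) \<Rightarrow> (real \<Rightarrow> real) \<Rightarrow> bool" where
  "admissible_curve \<epsilon> a b u v \<longleftrightarrow>
     smooth_on_interval {a..b} u \<and> smooth_on_interval {a..b} v \<and>
     curve u v ` {a..b} \<subseteq> de_sitter_yz_pos \<and>
     nondegenerate \<epsilon> {a..b} (curve u v)"

text \<open>
  A variation of \<open>\<Psi>(u, v)\<close> with fixed end points, through admissible curves of the same causal
  character.  Since \<open>\<Psi>\<close> is a covering map onto the de Sitter surface, every variation of the
  curve in the surface is of the form \<open>\<Psi>(U s t, V s t)\<close>.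
\<close>

definition admissible_variation ::
  "real \<Rightarrow> real \<Rightarrow> real \<Rightarrow> (real \<Rightarrow> real) \<Rightarrow> (real \<Rightarrow> real) \<Rightarrow>
   real \<Rightarrow> (real \<Rightarrow> real \<Rightarrow> real) \<Rightarrow> (real \<Rightarrow> real \<Rightarrow> real) \<Rightarrow> bool" where
  "admissible_variation \<epsilon> a b u v \<delta> U V \<longleftrightarrow>
     \<delta> > 0 \<and>
     smooth_on_strip {-\<delta><..<\<delta>} {a..b} U \<and> smooth_on_strip {-\<delta><..<\<delta>} {a..b} V \<and>
     (\<forall>t\<in>{a..b}. U 0 t = u t \<and> V 0 t = v t) \<and>
     (\<forall>s\<in>{-\<delta><..<\<delta>}. U s a = u a \<and> U s b = u b \<and> V s a = v a \<and> V s b = v b) \<and>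
     (\<forall>s\<in>{-\<delta><..<\<delta>}. admissible_curve \<epsilon> a b (U s) (V s))"

definition catenary_yz ::
  "real \<Rightarrow> real \<Rightarrow> real \<Rightarrow> real \<Rightarrow> (real \<Rightarrow> real) \<Rightarrow> (real \<Rightarrow> real) \<Rightarrow> bool" where
  "catenary_yz \<epsilon> lam a b u v \<longleftrightarrow>
     admissible_curve \<epsilon> a b u v \<and>
     (\<forall>\<delta> U V. admissible_variation \<epsilon> a b u v \<delta> U V \<longrightarrow>
        ((\<lambda>s. energy_yz \<epsilon> lam a b (U s) (V s)) has_real_derivative 0) (at 0))"

end

theory Submission
  imports Defs
begin

text \<open>
  For a variation field \<open>p \<Psi>\<^sub>u + q \<Psi>\<^sub>v\<close> vanishing at the end points, differentiation under the
  integral and integration by parts give the first variation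
  \<open>\<integral> k cosh u (u' q - v' p) / |\<gamma>'|\<^sup>3 dt\<close>, where, with \<open>N = \<gamma> \<times> \<gamma>'\<close>,
  \<open>k = \<langle>N, T\<rangle> \<langle>\<gamma>', \<gamma>'\<rangle> - (d + \<lambda>) det(\<gamma>, \<gamma>', \<gamma>'')\<close>; the curvature equation says exactly \<open>k = 0\<close>.
  Conversely, no bump functions are needed: the expression \<open>k\<close> is itself smooth, so the normal
  variation \<open>p = - v' h\<close>, \<open>q = u' h\<close> with \<open>h = (t - a) (b - t) k\<close> is admissible, and it makes the
  integrand nonnegative.
\<close>

section \<open>Smooth functions on an interval\<close>

lemma has_field_derivative_transform_on:
  assumes "(f has_field_derivative f') (at x within S)" "x \<in> S" "\<And>y. y \<in> S \<Longrightarrow> f y = g y"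
  shows "(g has_field_derivative f') (at x within S)"
  using assms has_derivative_transform[of x S g f] unfolding has_field_derivative_def by simp

text \<open>A function \<open>d\<close> that chooses a derivative inside \<open>F\<close> can be
  iterated without end, so the iterates \<open>(d ^^ n) f\<close> form the required list of
  successive derivatives.\<close>

lemma smooth_on_interval_coinduct:
  assumes "f \<in> F"
    and step: "\<And>g. g \<in> F \<Longrightarrow> \<exists>g'\<in>F. \<forall>t\<in>I. (g has_real_derivative g' t) (at t within I)"
  shows "smooth_on_interval I f"
proof -
  obtain d where d: "\<And>g. g \<in> F \<Longrightarrow> d g \<in> F"
    "\<And>g t. g \<in> F \<Longrightarrow> t \<in> I \<Longrightarrow> (g has_real_derivative d g t) (at t within I)"
    using step by metis
  have "(d ^^ n) f \<in> F" for n
    by (induction n) (auto simp: assms(1) d(1))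
  then show ?thesis
    unfolding smooth_on_interval_def
    by (intro exI[of _ "\<lambda>n. (d ^^ n) f"]) (auto intro: d(2))
qed

lemma smooth_on_intervalE:
  assumes "smooth_on_interval I f"
  obtains f' where "\<And>t. t \<in> I \<Longrightarrow> (f has_real_derivative f' t) (at t within I)"
    "smooth_on_interval I f'"
proof -
  obtain D where D: "\<And>t. t \<in> I \<Longrightarrow> D 0 t = f t"
    "\<And>n t. t \<in> I \<Longrightarrow> (D n has_real_derivative D (Suc n) t) (at t within I)"
    using assms unfolding smooth_on_interval_def by blast
  have "(f has_real_derivative D 1 t) (at t within I)" if "t \<in> I" for t
    using D(2)[OF that, of 0] that D(1) by (auto intro: has_field_derivative_transform_on)
  moreover have "smooth_on_interval I (D 1)"
    unfolding smooth_on_interval_def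
    by (intro exI[of _ "\<lambda>n. D (Suc n)"]) (auto intro: D(2))
  ultimately show ?thesis using that by blast
qed

text \<open>
  Unlike smooth functions themselves, this set is visibly closed under differentiation, which gives
  all the closure properties of smoothness at once.
\<close>

inductive_set smooth_algebra :: "real set \<Rightarrow> (real \<Rightarrow> real) set" for I where
  base: "smooth_on_interval I f \<Longrightarrow> f \<in> smooth_algebra I"
| const: "(\<lambda>t. c) \<in> smooth_algebra I"
| ident: "(\<lambda>t. t) \<in> smooth_algebra I"
| add: "f \<in> smooth_algebra I \<Longrightarrow> g \<in> smooth_algebra I \<Longrightarrow> (\<lambda>t. f t + g t) \<in> smooth_algebra I"
| mult: "f \<in> smooth_algebra I \<Longrightarrow> g \<in> smooth_algebra I \<Longrightarrow> (\<lambda>t. f t * g t) \<in> smooth_algebra I"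
| sin: "f \<in> smooth_algebra I \<Longrightarrow> (\<lambda>t. sin (f t)) \<in> smooth_algebra I"
| cos: "f \<in> smooth_algebra I \<Longrightarrow> (\<lambda>t. cos (f t)) \<in> smooth_algebra I"
| sinh: "f \<in> smooth_algebra I \<Longrightarrow> (\<lambda>t. sinh (f t)) \<in> smooth_algebra I"
| cosh: "f \<in> smooth_algebra I \<Longrightarrow> (\<lambda>t. cosh (f t)) \<in> smooth_algebra I"

lemma smooth_algebra_deriv:
  assumes "f \<in> smooth_algebra I"
  shows "\<exists>f'\<in>smooth_algebra I. \<forall>t\<in>I. (f has_real_derivative f' t) (at t within I)"
  using assms
proof induction
  case (base f)
  then show ?case by (meson smooth_algebra.base smooth_on_intervalE)
next
  case (const c)
  show ?case by (rule bexI[OF _ smooth_algebra.const[of 0]]) (auto intro!: derivative_eq_intros)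
next
  case ident
  show ?case by (rule bexI[OF _ smooth_algebra.const[of 1]]) (auto intro!: derivative_eq_intros)
next
  case (add f g)
  then obtain f' g' where "f' \<in> smooth_algebra I" "g' \<in> smooth_algebra I"
    "\<And>t. t \<in> I \<Longrightarrow> (f has_real_derivative f' t) (at t within I)"
    "\<And>t. t \<in> I \<Longrightarrow> (g has_real_derivative g' t) (at t within I)" by blast
  then show ?case
    by (intro bexI[of _ "\<lambda>t. f' t + g' t"]) (auto intro!: derivative_eq_intros smooth_algebra.add)
next
  case (mult f g)
  then obtain f' g' where "f' \<in> smooth_algebra I" "g' \<in> smooth_algebra I"
    "\<And>t. t \<in> I \<Longrightarrow> (f has_real_derivative f' t) (at t within I)"
    "\<And>t. t \<in> I \<Longrightarrow> (g has_real_derivative g' t) (at t within I)" by blast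
  with mult(1,2) show ?case
    by (intro bexI[of _ "\<lambda>t. f' t * g t + g' t * f t"])
      (auto intro!: derivative_eq_intros smooth_algebra.add smooth_algebra.mult)
next
  case (sin f)
  then obtain f' where "f' \<in> smooth_algebra I"
    "\<And>t. t \<in> I \<Longrightarrow> (f has_real_derivative f' t) (at t within I)" by blast
  with sin(1) show ?case
    by (intro bexI[of _ "\<lambda>t. cos (f t) * f' t"])
      (auto intro!: derivative_eq_intros smooth_algebra.cos smooth_algebra.mult)
next
  case (cos f)
  then obtain f' where "f' \<in> smooth_algebra I"
    "\<And>t. t \<in> I \<Longrightarrow> (f has_real_derivative f' t) (at t within I)" by blast
  \<comment> \<open>The minus sign is written as a constant factor: the algebra has rules for
    constants, sums and products, but none for negation.\<close>
  with cos(1) show ?case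
    by (intro bexI[of _ "\<lambda>t. sin (f t) * ((- 1) * f' t)"] smooth_algebra.intros(2-) ballI)
      (auto intro!: derivative_eq_intros)
next
  case (sinh f)
  then obtain f' where "f' \<in> smooth_algebra I"
    "\<And>t. t \<in> I \<Longrightarrow> (f has_real_derivative f' t) (at t within I)" by blast
  with sinh(1) show ?case
    by (intro bexI[of _ "\<lambda>t. cosh (f t) * f' t"])
      (auto intro!: derivative_eq_intros smooth_algebra.cosh smooth_algebra.mult)
next
  case (cosh f)
  then obtain f' where "f' \<in> smooth_algebra I"
    "\<And>t. t \<in> I \<Longrightarrow> (f has_real_derivative f' t) (at t within I)" by blast
  with cosh(1) show ?case
    by (intro bexI[of _ "\<lambda>t. sinh (f t) * f' t"])
      (auto intro!: derivative_eq_intros smooth_algebra.sinh smooth_algebra.mult)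
qed

text \<open>The algebra is closed under differentiation, so it can serve as the invariant set of the
  coinduction.\<close>

lemma smooth_on_interval_iff_algebra: "smooth_on_interval I f \<longleftrightarrow> f \<in> smooth_algebra I"
  using smooth_on_interval_coinduct[OF _ smooth_algebra_deriv] smooth_algebra.base by blast

lemmas smooth_on_interval_intros =
  smooth_algebra.intros(2-)[folded smooth_on_interval_iff_algebra]

lemma smooth_on_interval_minus:
  "smooth_on_interval I f \<Longrightarrow> smooth_on_interval I (\<lambda>t. - f t)"
  using smooth_on_interval_intros(4)[OF smooth_on_interval_intros(1)[of I "- 1"]] by simp

lemma smooth_on_interval_diff:
  "smooth_on_interval I f \<Longrightarrow> smooth_on_interval I g \<Longrightarrow> smooth_on_interval I (\<lambda>t. f t - g t)"
  using smooth_on_interval_intros(3)[OF _ smooth_on_interval_minus] by fastforce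

lemma smooth_on_interval_power:
  "smooth_on_interval I f \<Longrightarrow> smooth_on_interval I (\<lambda>t. f t ^ n)"
  by (induction n) (auto intro: smooth_on_interval_intros)

lemma smooth_on_interval_continuous:
  "smooth_on_interval I f \<Longrightarrow> continuous_on I f"
  by (erule smooth_on_intervalE) (metis DERIV_continuous continuous_on_eq_continuous_within)

section \<open>Two-parameter families\<close>

lemma smooth_on_stripE:
  assumes "smooth_on_strip S I F"
  obtains D where "\<And>s t. s \<in> S \<Longrightarrow> t \<in> I \<Longrightarrow> D 0 0 s t = F s t"
    "\<And>i j. continuous_on (S \<times> I) (\<lambda>(s, t). D i j s t)"
    "\<And>i j s t. s \<in> S \<Longrightarrow> t \<in> I \<Longrightarrow>
      ((\<lambda>s'. D i j s' t) has_real_derivative D (Suc i) j s t) (at s within S)"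
    "\<And>i j s t. s \<in> S \<Longrightarrow> t \<in> I \<Longrightarrow>
      ((\<lambda>t'. D i j s t') has_real_derivative D i (Suc j) s t) (at t within I)"
  using assms unfolding smooth_on_strip_def by metis

text \<open>Restricts jointly continuous functions to a slice with fixed parameter, through
  \<open>continuous_on_compose2\<close>.\<close>

lemma continuous_on_Pair_right: "continuous_on A (Pair s)"
  by (rule continuous_on_Pair[OF continuous_on_const continuous_on_id])

lemma smooth_on_strip_linear:
  assumes "smooth_on_interval I f" "smooth_on_interval I g"
  shows "smooth_on_strip S I (\<lambda>s t. f t + s * g t)"
proof -
  obtain Df where Df: "\<And>t. t \<in> I \<Longrightarrow> Df 0 t = f t"
    "\<And>n t. t \<in> I \<Longrightarrow> (Df n has_real_derivative Df (Suc n) t) (at t within I)"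
    using assms(1) unfolding smooth_on_interval_def by blast
  obtain Dg where Dg: "\<And>t. t \<in> I \<Longrightarrow> Dg 0 t = g t"
    "\<And>n t. t \<in> I \<Longrightarrow> (Dg n has_real_derivative Dg (Suc n) t) (at t within I)"
    using assms(2) unfolding smooth_on_interval_def by blast
  \<comment> \<open>The family is affine in the parameter: one derivative in \<open>s\<close> leaves
    \<open>g\<close>, any further one gives zero.\<close>
  define D where "D i j s t =
    (if i = 0 then Df j t + s * Dg j t else if i = 1 then Dg j t else 0)" for i j :: nat and s t
  have cont: "continuous_on I (Df n)" "continuous_on I (Dg n)" for n
    using Df(2) Dg(2) by (metis DERIV_continuous continuous_on_eq_continuous_within)+
  have cont2: "continuous_on (S \<times> I) (\<lambda>x. Df n (snd x))"
    "continuous_on (S \<times> I) (\<lambda>x. Dg n (snd x))" for n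
    by (auto intro!: continuous_on_compose2[OF cont(1)] continuous_on_compose2[OF cont(2)]
        continuous_intros)
  have "continuous_on (S \<times> I) (\<lambda>(s, t). D i j s t)" for i j
  proof -
    consider "i = 0" | "i = 1" | "i > 1" by linarith
    then show ?thesis
      by cases (auto simp: D_def case_prod_beta intro!: continuous_intros cont2)
  qed
  moreover have "((\<lambda>s'. D i j s' t) has_real_derivative D (Suc i) j s t) (at s within S)" for i j s t
  proof -
    consider "i = 0" | "i = 1" | "i > 1" by linarith
    then show ?thesis
      by cases (auto simp: D_def intro!: derivative_eq_intros)
  qed
  moreover have "((\<lambda>t'. D i j s t') has_real_derivative D i (Suc j) s t) (at t within I)"
    if "t \<in> I" for i j s t
  proof -
    consider "i = 0" | "i = 1" | "i > 1" by linarith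
    then show ?thesis
      by cases (auto simp: D_def intro!: derivative_eq_intros Df(2) Dg(2) that)
  qed
  moreover have "D 0 0 s t = f t + s * g t" if "t \<in> I" for s t
    using that by (simp add: D_def Df(1) Dg(1))
  ultimately show ?thesis
    unfolding smooth_on_strip_def by (intro exI[of _ D] conjI allI ballI) blast+
qed

section \<open>Velocity, and derivative rules for square roots and quotients\<close>

lemma velocity_eq_real_derivative:
  assumes "a < b" "t \<in> {a..b}" "(f has_real_derivative f') (at t within {a..b})"
  shows "velocity {a..b} f t = f'"
  \<comment> \<open>\<open>a < b\<close> makes the derivative within the interval unique, also at
    the end points.\<close>
  using assms unfolding velocity_def
  by (intro vector_derivative_within_closed_interval)
    (auto simp: has_real_derivative_iff_has_vector_derivative)

text \<open>Meant for the squared speed, whose derivatives carry a factor 2 that cancels the one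
  from the square root.\<close>

lemma has_real_derivative_sqrt_half:
  assumes "(f has_real_derivative 2 * d) (at x within S)" "f x > 0"
  shows "((\<lambda>x. sqrt (f x)) has_real_derivative d / sqrt (f x)) (at x within S)"
  by (rule DERIV_cong[OF DERIV_chain2[OF DERIV_real_sqrt[OF assms(2)] assms(1)]])
    (simp add: field_simps)

text \<open>The quotient rule with its two terms kept apart, the shape that the derivative of the
  boundary term takes in \<open>lagrangian_variation_identity\<close>.\<close>

lemma has_real_derivative_mult_divide:
  fixes f g h :: "real \<Rightarrow> real"
  assumes "(f has_real_derivative f') (at x within S)" "(g has_real_derivative g') (at x within S)"
    "(h has_real_derivative h') (at x within S)" "h x \<noteq> 0"
  shows "((\<lambda>x. f x * g x / h x) has_real_derivative
    (f' * g x + f x * g') / h x - f x * g x * h' / (h x)\<^sup>2) (at x within S)"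
proof -
  have "((f' * g x + g' * f x) * h x - f x * g x * h') / (h x * h x) =
      (f' * g x + f x * g') / h x - f x * g x * h' / (h x)\<^sup>2"
    using assms(4) by (simp add: field_simps power2_eq_square)
  with DERIV_divide[OF DERIV_mult[OF assms(1,2)] assms(3,4)] show ?thesis by simp
qed

section \<open>Curves in the chart\<close>

text \<open>
  In the following definitions \<open>x, y\<close> are the coordinates \<open>u, v\<close>, and \<open>x1, y1, x2, y2\<close> their first
  and second derivatives.  The expressions \<open>metric_yz\<close>, \<open>normal_yz\<close> and \<open>det_yz\<close> are
  \<open>\<langle>\<gamma>', \<gamma>'\<rangle>\<close>, \<open>\<langle>\<gamma> \<times> \<gamma>', T\<rangle>\<close> and \<open>det(\<gamma>, \<gamma>', \<gamma>'')\<close>.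
\<close>

definition metric_yz :: "real \<Rightarrow> real \<Rightarrow> real \<Rightarrow> real" where
  "metric_yz x x1 y1 = y1\<^sup>2 * (cosh x)\<^sup>2 - x1\<^sup>2"

definition normal_yz :: "real \<Rightarrow> real \<Rightarrow> real \<Rightarrow> real \<Rightarrow> real" where
  "normal_yz x y x1 y1 = - (x1 * cos y + y1 * cosh x * (sinh x * sin y - cosh x))"

definition det_yz :: "real \<Rightarrow> real \<Rightarrow> real \<Rightarrow> real \<Rightarrow> real \<Rightarrow> real" where
  "det_yz x x1 y1 x2 y2 =
     - (cosh x * x1 * y2 + 2 * x1\<^sup>2 * y1 * sinh x - y1 * x2 * cosh x - y1 ^ 3 * (cosh x)\<^sup>2 * sinh x)"

definition euler_lagrange_yz ::
  "real \<Rightarrow> real \<Rightarrow> real \<Rightarrow> real \<Rightarrow> real \<Rightarrow> real \<Rightarrow> real \<Rightarrow> real" where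
  "euler_lagrange_yz lam x y x1 y1 x2 y2 =
     normal_yz x y x1 y1 * metric_yz x x1 y1
     - (cosh x * sin y - sinh x + lam) * det_yz x x1 y1 x2 y2"

text \<open>\<open>dPsi\<close> and \<open>ddPsi\<close> are the chain rule expansions of \<gamma>'
  and \<gamma>''. Taking the coordinates and their derivatives as free reals turns the geometric
  identities below into algebra.\<close>

definition dPsi :: "real \<Rightarrow> real \<Rightarrow> real \<Rightarrow> real \<Rightarrow> real^3" where
  "dPsi x y x1 y1 = vector
     [sinh x * cos y * x1 - cosh x * sin y * y1, sinh x * sin y * x1 + cosh x * cos y * y1, cosh x * x1]"

definition ddPsi :: "real \<Rightarrow> real \<Rightarrow> real \<Rightarrow> real \<Rightarrow> real \<Rightarrow> real \<Rightarrow> real^3" where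
  "ddPsi x y x1 y1 x2 y2 = vector
     [cosh x * cos y * x1\<^sup>2 - 2 * sinh x * sin y * x1 * y1 - cosh x * cos y * y1\<^sup>2
        + sinh x * cos y * x2 - cosh x * sin y * y2,
      cosh x * sin y * x1\<^sup>2 + 2 * sinh x * cos y * x1 * y1 - cosh x * sin y * y1\<^sup>2
        + sinh x * sin y * x2 + cosh x * cos y * y2,
      sinh x * x1\<^sup>2 + cosh x * x2]"

lemma has_vector_derivative_vector_3:
  assumes "(f has_real_derivative f') F" "(g has_real_derivative g') F" "(h has_real_derivative h') F"
  shows "((\<lambda>t. vector [f t, g t, h t] :: real^3) has_vector_derivative vector [f', g', h']) F"
proof -
  \<comment> \<open>Over the standard basis the curve is a sum of real functions times constant
    vectors, so each coordinate is differentiated alone.\<close>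
  have *: "(vector [p, q, r] :: real^3) = p *\<^sub>R axis 1 1 + q *\<^sub>R axis 2 1 + r *\<^sub>R axis 3 1" for p q r
    by (simp add: vec_eq_iff forall_3 vector_3 axis_def)
  have scale: "((\<lambda>t. k t *\<^sub>R c) has_vector_derivative k' *\<^sub>R c) F"
    if "(k has_real_derivative k') F" for k k' and c :: "real^3"
    using bounded_linear.has_vector_derivative[OF bounded_linear_scaleR_left] that
    by (simp add: has_real_derivative_iff_has_vector_derivative)
  show ?thesis
    unfolding * by (intro has_vector_derivative_add scale assms)
qed

text \<open>The derivatives are parameters, so that the results apply to the given curve and equally
  to each curve of a variation, where they are partial derivatives.\<close>

locale chart_curve =
  fixes a b :: real and u v u1 v1 u2 v2 :: "real \<Rightarrow> real"
  assumes ab: "a < b"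
    and du: "t \<in> {a..b} \<Longrightarrow> (u has_real_derivative u1 t) (at t within {a..b})"
    and dv: "t \<in> {a..b} \<Longrightarrow> (v has_real_derivative v1 t) (at t within {a..b})"
    and du1: "t \<in> {a..b} \<Longrightarrow> (u1 has_real_derivative u2 t) (at t within {a..b})"
    and dv1: "t \<in> {a..b} \<Longrightarrow> (v1 has_real_derivative v2 t) (at t within {a..b})"
begin

lemma velocity_curve:
  assumes "t \<in> {a..b}"
  shows "velocity {a..b} (curve u v) t = dPsi (u t) (v t) (u1 t) (v1 t)"
proof -
  have "((\<lambda>t. curve u v t) has_vector_derivative dPsi (u t) (v t) (u1 t) (v1 t)) (at t within {a..b})"
    unfolding curve_def Psi_def dPsi_def using du[OF assms] dv[OF assms]
    by (intro has_vector_derivative_vector_3) (auto intro!: derivative_eq_intros)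
  then show ?thesis
    unfolding velocity_def using ab assms by (intro vector_derivative_within_closed_interval) auto
qed

lemma acceleration_curve:
  assumes "t \<in> {a..b}"
  shows "acceleration {a..b} (curve u v) t = ddPsi (u t) (v t) (u1 t) (v1 t) (u2 t) (v2 t)"
proof -
  have "((\<lambda>t. dPsi (u t) (v t) (u1 t) (v1 t)) has_vector_derivative
      ddPsi (u t) (v t) (u1 t) (v1 t) (u2 t) (v2 t)) (at t within {a..b})"
    unfolding ddPsi_def dPsi_def using du[OF assms] dv[OF assms] du1[OF assms] dv1[OF assms]
    by (intro has_vector_derivative_vector_3)
      (auto intro!: derivative_eq_intros simp: algebra_simps power2_eq_square)
  then have "(velocity {a..b} (curve u v) has_vector_derivative
      ddPsi (u t) (v t) (u1 t) (v1 t) (u2 t) (v2 t)) (at t within {a..b})"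
    by (rule has_vector_derivative_transform[OF assms, rotated]) (simp add: velocity_curve)
  then show ?thesis
    unfolding acceleration_def velocity_def[of _ "velocity _ _"]
    using ab assms by (intro vector_derivative_within_closed_interval) auto
qed

end

section \<open>Lorentz products in coordinates and the curvature equation\<close>

lemma lprod_dPsi: "lprod (dPsi x y x1 y1) (dPsi x y x1 y1) = metric_yz x x1 y1"
proof -
  \<comment> \<open>Modulo these two relations the claim is a polynomial identity; the same
    elimination proves the two lemmas that follow.\<close>
  have "(sin y)\<^sup>2 = 1 - (cos y)\<^sup>2" "(sinh x)\<^sup>2 = (cosh x)\<^sup>2 - 1"
    by (auto simp: sin_squared_eq cosh_square_eq)
  then show ?thesis
    unfolding lprod_def dPsi_def metric_yz_def vector_3 by algebra
qed

lemma lprod_lcross_dPsi_T: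
  "lprod (lcross (Psi x y) (dPsi x y x1 y1)) T_yz = normal_yz x y x1 y1"
proof -
  have "(sin y)\<^sup>2 = 1 - (cos y)\<^sup>2" "(sinh x)\<^sup>2 = (cosh x)\<^sup>2 - 1"
    by (auto simp: sin_squared_eq cosh_square_eq)
  then show ?thesis
    unfolding lprod_def lcross_def Psi_def dPsi_def normal_yz_def T_yz_def vector_3 by algebra
qed

lemma lprod_lcross_ddPsi:
  "lprod (ddPsi x y x1 y1 x2 y2) (lcross (dPsi x y x1 y1) (- Psi x y)) = det_yz x x1 y1 x2 y2"
proof -
  have "(sin y)\<^sup>2 = 1 - (cos y)\<^sup>2" "(sinh x)\<^sup>2 = (cosh x)\<^sup>2 - 1"
    by (auto simp: sin_squared_eq cosh_square_eq)
  then show ?thesis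
    unfolding lprod_def lcross_def Psi_def dPsi_def ddPsi_def det_yz_def vector_3
      vector_uminus_component
    by algebra
qed

lemma (in chart_curve) nondegenerate_curve_iff:
  "nondegenerate \<epsilon> {a..b} (curve u v) \<longleftrightarrow>
     (\<epsilon> = 1 \<or> \<epsilon> = - 1) \<and> (\<forall>t\<in>{a..b}. \<epsilon> * metric_yz (u t) (u1 t) (v1 t) > 0)"
  unfolding nondegenerate_def spacelike_def timelike_def
  by (auto simp: velocity_curve lprod_dPsi)

lemma (in chart_curve) curvature_equation_iff:
  assumes nd: "nondegenerate \<epsilon> {a..b} (curve u v)" and t: "t \<in> {a..b}"
    and nz: "dist_yz (curve u v t) + lam \<noteq> 0"
  shows "curvature \<epsilon> {a..b} (curve u v) t =
      - lprod (principal_normal \<epsilon> {a..b} (curve u v) t) T_yz / (dist_yz (curve u v t) + lam)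
    \<longleftrightarrow> euler_lagrange_yz lam (u t) (v t) (u1 t) (v1 t) (u2 t) (v2 t) = 0"
proof -
  define w where "w = speed \<epsilon> {a..b} (curve u v) t"
  define Q where "Q = metric_yz (u t) (u1 t) (v1 t)"
  define F where "F = cosh (u t) * sin (v t) - sinh (u t) + lam"
  define N where "N = normal_yz (u t) (v t) (u1 t) (v1 t)"
  define d where "d = det_yz (u t) (u1 t) (v1 t) (u2 t) (v2 t)"
  have eps: "\<epsilon> * \<epsilon> = 1" and pos: "\<epsilon> * Q > 0"
    using nd t by (auto simp: nondegenerate_curve_iff Q_def)
  have w: "w = sqrt (\<epsilon> * Q)"
    using t by (simp add: w_def speed_def velocity_curve lprod_dPsi Q_def)
  have w0: "w \<noteq> 0" and w2: "w\<^sup>2 = \<epsilon> * Q" using pos by (auto simp: w)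
  have F: "dist_yz (curve u v t) + lam = F"
    by (simp add: F_def dist_yz_def curve_def Psi_def vector_3)
  have k: "curvature \<epsilon> {a..b} (curve u v) t = \<epsilon> * d / w ^ 3"
    using t by (simp add: curvature_def velocity_curve acceleration_curve \<xi>_def curve_def
        lprod_lcross_ddPsi d_def w_def)
  have lin: "lprod (c *\<^sub>R lcross (- p) q) r = - (c * lprod (lcross p q) r)" for c p q r
    by (simp add: lprod_def lcross_def vector_3 algebra_simps)
  have n: "lprod (principal_normal \<epsilon> {a..b} (curve u v) t) T_yz = - (N / w)"
    using t by (simp add: principal_normal_def velocity_curve \<xi>_def curve_def lin
        lprod_lcross_dPsi_T N_def flip: w_def)
  \<comment> \<open>Multiplying by \<open>w ^ 3 * F\<close> leaves the speed only as
    \<open>w\<^sup>2\<close>, which is then replaced by \<open>\<epsilon> * Q\<close>.\<close>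
  have "\<epsilon> * d / w ^ 3 = N / w / F \<longleftrightarrow> \<epsilon> * d * F = N * w\<^sup>2"
    using w0 nz unfolding F by (simp add: field_simps power2_eq_square power3_eq_cube)
  also have "\<dots> \<longleftrightarrow> \<epsilon> * (N * Q - F * d) = 0"
    unfolding w2 by (auto simp: algebra_simps)
  also have "\<dots> \<longleftrightarrow> N * Q - F * d = 0" using eps by auto
  finally show ?thesis
    unfolding k n F by (simp add: euler_lagrange_yz_def N_def Q_def F_def d_def)
qed

section \<open>The first variation of the energy\<close>

text \<open>
  With \<open>p\<close>, \<open>q\<close> the components of the variation field, the \<open>s\<close>-derivative of the Lagrangian is the
  derivative of the boundary term \<open>\<epsilon> F M / w\<close> plus a multiple of the Euler-Lagrange expression.
  Only the combination \<open>u' q - v' p\<close> survives because reparametrizations do not change the energy.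
\<close>

lemma lagrangian_variation_identity:
  fixes x y x1 y1 x2 y2 p q p1 q1 w \<epsilon> lam :: real
  defines "F \<equiv> cosh x * sin y - sinh x + lam"
    and "M \<equiv> y1 * (cosh x)\<^sup>2 * q - x1 * p"
    and "M1 \<equiv> y2 * (cosh x)\<^sup>2 * q + 2 * y1 * cosh x * sinh x * x1 * q + y1 * (cosh x)\<^sup>2 * q1
            - x2 * p - x1 * p1"
    and "F1 \<equiv> (sinh x * sin y - cosh x) * x1 + cosh x * cos y * y1"
    and "W \<equiv> y1 * y2 * (cosh x)\<^sup>2 + y1\<^sup>2 * cosh x * sinh x * x1 - x1 * x2"
  assumes w: "w \<noteq> 0" "w\<^sup>2 = \<epsilon> * metric_yz x x1 y1" and eps: "\<epsilon> * \<epsilon> = 1"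
  shows "((sinh x * sin y - cosh x) * p + cosh x * cos y * q) * w
      + F * (\<epsilon> * (y1 * q1 * (cosh x)\<^sup>2 + y1\<^sup>2 * cosh x * sinh x * p - x1 * p1) / w)
    = \<epsilon> * ((F1 * M + F * M1) / w - F * M * (\<epsilon> * W / w) / w\<^sup>2)
      + euler_lagrange_yz lam x y x1 y1 x2 y2 * cosh x * (x1 * q - y1 * p) / w ^ 3"
    (is "?l = ?r")
proof -
  define Q where "Q = metric_yz x x1 y1"
  define R where "R = y1 * q1 * (cosh x)\<^sup>2 + y1\<^sup>2 * cosh x * sinh x * p - x1 * p1"
  define A where "A = (sinh x * sin y - cosh x) * p + cosh x * cos y * q"
  define N where "N = normal_yz x y x1 y1"
  define d where "d = det_yz x x1 y1 x2 y2"
  define H where "H = cosh x * (x1 * q - y1 * p)"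
  \<comment> \<open>For the variation field X, \<open>M\<close> is \<langle>\<gamma>', X\<rangle>
    and \<open>H\<close> the oriented area of \<gamma>' and X. Multiplied by \<open>Q\<close>, X
    splits into a tangential and a normal part; \<open>A\<close> and \<open>F1\<close> are the
    derivatives of the distance along X and \<gamma>'.\<close>
  have A: "A * Q = F1 * M + N * H"
    unfolding A_def Q_def F1_def M_def N_def H_def normal_yz_def metric_yz_def by algebra
  \<comment> \<open>\<open>R\<close> and \<open>W\<close> are half the derivatives of
    \<open>Q\<close> along the variation and along the curve, and \<open>M1\<close> is the
    derivative of \<open>M\<close> along the curve: the product rule for \<langle>\<gamma>',
    X\<rangle> combined with the same splitting.\<close>
  have R: "R * Q = M1 * Q - M * W - d * H"
    unfolding R_def Q_def M_def M1_def W_def d_def H_def det_yz_def metric_yz_def by algebra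
  have w2: "w\<^sup>2 = \<epsilon> * Q" using w(2) by (simp add: Q_def)
  \<comment> \<open>After clearing \<open>w ^ 3\<close> the speed enters only through
    \<open>w\<^sup>2 = \<epsilon> * Q\<close>, and \<open>\<epsilon> * \<epsilon> = 1\<close>
    absorbs the causal sign.\<close>
  have "?l * w ^ 3 = A * (w\<^sup>2)\<^sup>2 + F * (\<epsilon> * R) * w\<^sup>2"
    using w(1) by (simp flip: A_def R_def)
      (simp add: field_simps power2_eq_square power3_eq_cube power4_eq_xxxx)
  also have "\<dots> = (A * Q) * Q + F * (R * Q)"
    unfolding w2 using eps by algebra
  also have "\<dots> = (F1 * M + F * M1) * Q - F * M * W + (N * Q - F * d) * H"
    unfolding A R by algebra
  also have "\<dots> = \<epsilon> * (F1 * M + F * M1) * w\<^sup>2 - F * M * (\<epsilon> * \<epsilon> * W) + (N * Q - F * d) * H"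
    unfolding w2 using eps by algebra
  also have "\<dots> = (\<epsilon> * ((F1 * M + F * M1) / w - F * M * (\<epsilon> * W / w) / w\<^sup>2)
      + (N * Q - F * d) * H / w ^ 3) * w ^ 3"
    using w(1) by (simp add: field_simps power2_eq_square power3_eq_cube)
  also have "\<dots> = ?r * w ^ 3"
    by (simp add: euler_lagrange_yz_def N_def Q_def F_def d_def H_def mult.assoc)
  finally show ?thesis using w(1) by simp
qed

text \<open>The variation is arbitrary, so the formula serves both directions of the theorem: all
  variations when the curvature equation holds, and a single linear one for the converse.\<close>

lemma (in chart_curve) energy_first_variation:
  fixes lam :: real
  assumes adm: "admissible_variation \<epsilon> a b u v \<delta> U V"
    and p: "\<And>t. t \<in> {a..b} \<Longrightarrow> ((\<lambda>s. U s t) has_real_derivative p t) (at 0)"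
    and q: "\<And>t. t \<in> {a..b} \<Longrightarrow> ((\<lambda>s. V s t) has_real_derivative q t) (at 0)"
  defines "G \<equiv> \<lambda>t. euler_lagrange_yz lam (u t) (v t) (u1 t) (v1 t) (u2 t) (v2 t) * cosh (u t) *
      (u1 t * q t - v1 t * p t) / (sqrt (\<epsilon> * metric_yz (u t) (u1 t) (v1 t))) ^ 3"
  shows "\<exists>E. ((\<lambda>s. energy_yz \<epsilon> lam a b (U s) (V s)) has_real_derivative E) (at 0) \<and>
           (G has_integral E) {a..b}"
proof -
  define S where "S = {-\<delta><..<\<delta>}"
  have \<delta>: "\<delta> > 0" and S0: "0 \<in> S" and openS: "open S" and convS: "convex S"
    using adm by (auto simp: admissible_variation_def S_def)
  obtain DU where DU: "\<And>s t. s \<in> S \<Longrightarrow> t \<in> {a..b} \<Longrightarrow> DU 0 0 s t = U s t"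
    "\<And>i j. continuous_on (S \<times> {a..b}) (\<lambda>(s, t). DU i j s t)"
    "\<And>i j s t. s \<in> S \<Longrightarrow> t \<in> {a..b} \<Longrightarrow>
      ((\<lambda>s'. DU i j s' t) has_real_derivative DU (Suc i) j s t) (at s within S)"
    "\<And>i j s t. s \<in> S \<Longrightarrow> t \<in> {a..b} \<Longrightarrow>
      ((\<lambda>t'. DU i j s t') has_real_derivative DU i (Suc j) s t) (at t within {a..b})"
    by (rule smooth_on_stripE[of S "{a..b}" U])
      (use adm in \<open>auto simp: admissible_variation_def S_def\<close>)
  obtain DV where DV: "\<And>s t. s \<in> S \<Longrightarrow> t \<in> {a..b} \<Longrightarrow> DV 0 0 s t = V s t"
    "\<And>i j. continuous_on (S \<times> {a..b}) (\<lambda>(s, t). DV i j s t)"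
    "\<And>i j s t. s \<in> S \<Longrightarrow> t \<in> {a..b} \<Longrightarrow>
      ((\<lambda>s'. DV i j s' t) has_real_derivative DV (Suc i) j s t) (at s within S)"
    "\<And>i j s t. s \<in> S \<Longrightarrow> t \<in> {a..b} \<Longrightarrow>
      ((\<lambda>t'. DV i j s t') has_real_derivative DV i (Suc j) s t) (at t within {a..b})"
    by (rule smooth_on_stripE[of S "{a..b}" V])
      (use adm in \<open>auto simp: admissible_variation_def S_def\<close>)
  have atS: "at s within S = at s" if "s \<in> S" for s
    using openS that by (rule at_within_open[rotated])
  have U0: "U 0 t = u t" "V 0 t = v t" if "t \<in> {a..b}" for t
    using adm that by (auto simp: admissible_variation_def)
  have dUt: "(U s has_real_derivative DU 0 1 s t) (at t within {a..b})" 
    and dVt: "(V s has_real_derivative DV 0 1 s t) (at t within {a..b})"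
    if "s \<in> S" "t \<in> {a..b}" for s t
    using has_field_derivative_transform_on[OF DU(4)[OF that, of 0 0] that(2), of "U s"]
      has_field_derivative_transform_on[OF DV(4)[OF that, of 0 0] that(2), of "V s"]
      DU(1) DV(1) that by auto
  have vel: "velocity {a..b} (U s) t = DU 0 1 s t" "velocity {a..b} (V s) t = DV 0 1 s t"
    if "s \<in> S" "t \<in> {a..b}" for s t
    using velocity_eq_real_derivative[OF ab that(2)] dUt dVt that by auto
  have cs: "chart_curve a b (U s) (V s) (DU 0 1 s) (DV 0 1 s) (DU 0 2 s) (DV 0 2 s)" if "s \<in> S" for s
    using ab that dUt dVt DU(4)[of s _ 0 1] DV(4)[of s _ 0 1]
    by unfold_locales (auto simp: numeral_2_eq_2)
  \<comment> \<open>\<open>m\<close> is the squared speed, \<open>L\<close> the Lagrangian and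
    \<open>Ls\<close> its derivative in \<open>s\<close>. They are written with \<open>DU\<close>
    and \<open>DV\<close>, whose joint continuity and partial derivatives are at hand.\<close>
  define m where "m s t = \<epsilon> * metric_yz (DU 0 0 s t) (DU 0 1 s t) (DV 0 1 s t)" for s t
  have mpos: "m s t > 0" and eps: "\<epsilon> * \<epsilon> = 1" if "s \<in> S" "t \<in> {a..b}" for s t
  proof -
    have "nondegenerate \<epsilon> {a..b} (curve (U s) (V s))"
      using adm that by (auto simp: admissible_variation_def admissible_curve_def S_def)
    then show "m s t > 0" "\<epsilon> * \<epsilon> = 1"
      using chart_curve.nondegenerate_curve_iff[OF cs[OF that(1)]] that DU(1)
      by (auto simp: m_def)
  qed
  define L where "L s t = (cosh (DU 0 0 s t) * sin (DV 0 0 s t) - sinh (DU 0 0 s t) + lam) * sqrt (m s t)"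
    for s t
  define Ls where "Ls s t =
      ((sinh (DU 0 0 s t) * sin (DV 0 0 s t) - cosh (DU 0 0 s t)) * DU 1 0 s t
        + cosh (DU 0 0 s t) * cos (DV 0 0 s t) * DV 1 0 s t) * sqrt (m s t)
      + (cosh (DU 0 0 s t) * sin (DV 0 0 s t) - sinh (DU 0 0 s t) + lam) *
        (\<epsilon> * (DV 0 1 s t * DV 1 1 s t * (cosh (DU 0 0 s t))\<^sup>2
            + (DV 0 1 s t)\<^sup>2 * cosh (DU 0 0 s t) * sinh (DU 0 0 s t) * DU 1 0 s t
            - DU 0 1 s t * DU 1 1 s t) / sqrt (m s t))" for s t
  have energy: "energy_yz \<epsilon> lam a b (U s) (V s) = integral {a..b} (L s)" if "s \<in> S" for s
    unfolding energy_yz_def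
    by (rule integral_cong) (use that in \<open>auto simp: L_def m_def metric_yz_def vel DU(1) DV(1)\<close>)
  have cont: "continuous_on (S \<times> {a..b}) (\<lambda>x. DU i j (fst x) (snd x))"
    "continuous_on (S \<times> {a..b}) (\<lambda>x. DV i j (fst x) (snd x))" for i j
    using DU(2) DV(2) by (simp_all add: case_prod_beta)
  have contm: "continuous_on (S \<times> {a..b}) (\<lambda>x. m (fst x) (snd x))"
    unfolding m_def metric_yz_def by (intro continuous_intros cont)
  have m0: "sqrt (m (fst x) (snd x)) \<noteq> 0" if "x \<in> S \<times> {a..b}" for x
    using that mpos[of "fst x" "snd x"] by auto
  have contL: "continuous_on (S \<times> {a..b}) (\<lambda>x. L (fst x) (snd x))"
    unfolding L_def by (intro continuous_intros cont contm)
  have contLs: "continuous_on (S \<times> {a..b}) (\<lambda>x. Ls (fst x) (snd x))"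
    unfolding Ls_def by (intro continuous_intros cont contm ballI m0)
  have "continuous_on {a..b} (L s)" if "s \<in> S" for s
    using continuous_on_compose2[OF contL, of "{a..b}" "\<lambda>t. (s, t)"] that
    by (auto simp: continuous_on_Pair_right image_subset_iff)
  then have intL: "L s integrable_on {a..b}" if "s \<in> S" for s
    using that integrable_continuous_real by blast
  have dm: "((\<lambda>s. m s t) has_real_derivative 2 * (\<epsilon> * (DV 0 1 s t * DV 1 1 s t * (cosh (DU 0 0 s t))\<^sup>2
            + (DV 0 1 s t)\<^sup>2 * cosh (DU 0 0 s t) * sinh (DU 0 0 s t) * DU 1 0 s t
            - DU 0 1 s t * DU 1 1 s t))) (at s within S)" if "s \<in> S" "t \<in> {a..b}" for s t
    unfolding m_def metric_yz_def
    by (rule derivative_eq_intros DU(3) DV(3) that refl)+ (simp add: algebra_simps)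
  have dL: "((\<lambda>s. L s t) has_real_derivative Ls s t) (at s within S)"
    if "s \<in> S" "t \<in> {a..b}" for s t
  proof -
    have dsqrt: "((\<lambda>s. sqrt (m s t)) has_real_derivative
         \<epsilon> * (DV 0 1 s t * DV 1 1 s t * (cosh (DU 0 0 s t))\<^sup>2
            + (DV 0 1 s t)\<^sup>2 * cosh (DU 0 0 s t) * sinh (DU 0 0 s t) * DU 1 0 s t
            - DU 0 1 s t * DU 1 1 s t) / sqrt (m s t)) (at s within S)"
      by (rule has_real_derivative_sqrt_half[OF dm[OF that] mpos[OF that]])
    show ?thesis
      unfolding L_def Ls_def
      by (rule derivative_eq_intros dsqrt DU(3) DV(3) that refl)+ (simp add: algebra_simps)
  qed
  \<comment> \<open>Joint continuity of \<open>Ls\<close> permits differentiation under the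
    integral; \<open>S\<close> is open, so the derivative at 0 becomes two-sided.\<close>
  have "((\<lambda>s. integral (cbox a b) (L s)) has_real_derivative integral (cbox a b) (Ls 0)) (at 0 within S)"
    using dL intL contLs S0 convS
    by (intro leibniz_rule_field_derivative) (auto simp: case_prod_beta)
  then have "((\<lambda>s. integral {a..b} (L s)) has_real_derivative integral {a..b} (Ls 0)) (at 0)"
    by (simp add: atS S0)
  then have dE: "((\<lambda>s. energy_yz \<epsilon> lam a b (U s) (V s)) has_real_derivative integral {a..b} (Ls 0)) (at 0)"
    by (rule has_field_derivative_transform_within_open[OF _ openS S0]) (simp add: energy)
  have pq: "DU 1 0 0 t = p t" "DV 1 0 0 t = q t" if "t \<in> {a..b}" for t
  proof -
    have "((\<lambda>s. U s t) has_real_derivative DU 1 0 0 t) (at 0 within S)"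
      using has_field_derivative_transform_on[OF DU(3)[OF S0 that, of 0 0] S0, of "\<lambda>s. U s t"]
        DU(1) that by auto
    moreover have "((\<lambda>s. V s t) has_real_derivative DV 1 0 0 t) (at 0 within S)"
      using has_field_derivative_transform_on[OF DV(3)[OF S0 that, of 0 0] S0, of "\<lambda>s. V s t"]
        DV(1) that by auto
    ultimately show "DU 1 0 0 t = p t" "DV 1 0 0 t = q t"
      using p[OF that] q[OF that] by (auto simp: atS S0 intro: DERIV_unique)
  qed
  \<comment> \<open>The end points do not move with \<open>s\<close>, so the variation field
    vanishes there.\<close>
  have ends: "p a = 0" "p b = 0" "q a = 0" "q b = 0"
  proof -
    have e: "U s a = u a" "U s b = u b" "V s a = v a" "V s b = v b" if "s \<in> S" for s
      using adm that by (auto simp: admissible_variation_def S_def)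
    have z: "d = 0" if "(f has_real_derivative d) (at 0)" "\<And>s. s \<in> S \<Longrightarrow> f s = c" for f d and c :: real
      using has_field_derivative_transform_within_open[OF that(1) openS S0 that(2)]
        DERIV_unique[OF DERIV_const] by metis
    show "p a = 0" "p b = 0" "q a = 0" "q b = 0"
      using z[OF p e(1)] z[OF p e(2)] z[OF q e(3)] z[OF q e(4)] ab by auto
  qed
  have D01: "DU 0 1 0 t = u1 t" "DV 0 1 0 t = v1 t" if "t \<in> {a..b}" for t
  proof -
    have "(u has_real_derivative DU 0 1 0 t) (at t within {a..b})"
         "(v has_real_derivative DV 0 1 0 t) (at t within {a..b})"
      using has_field_derivative_transform_on[OF dUt[OF S0 that] that, of u]
        has_field_derivative_transform_on[OF dVt[OF S0 that] that, of v] U0 by auto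
    then show "DU 0 1 0 t = u1 t" "DV 0 1 0 t = v1 t"
      using du[OF that] dv[OF that] velocity_eq_real_derivative[OF ab that] by metis+
  qed
  have D00: "DU 0 0 0 t = u t" "DV 0 0 0 t = v t" if "t \<in> {a..b}" for t
    using DU(1) DV(1) S0 U0 that by auto
  define w where "w t = sqrt (\<epsilon> * metric_yz (u t) (u1 t) (v1 t))" for t
  have wm: "w t = sqrt (m 0 t)" if "t \<in> {a..b}" for t
    using that by (simp add: w_def m_def D00 D01[unfolded One_nat_def])
  have mpos0: "\<epsilon> * metric_yz (u t) (u1 t) (v1 t) > 0" if "t \<in> {a..b}" for t
    using mpos[OF S0 that] that by (simp add: m_def D00 D01[unfolded One_nat_def])
  \<comment> \<open>The boundary term of the integration by parts; \<open>dB\<close> identifies its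
    derivative as \<open>Ls 0 t - G t\<close>.\<close>
  define B where "B t = \<epsilon> * ((cosh (u t) * sin (v t) - sinh (u t) + lam)
      * (v1 t * (cosh (u t))\<^sup>2 * q t - u1 t * p t) / w t)" for t
  have dw: "(w has_real_derivative \<epsilon> * (v1 t * v2 t * (cosh (u t))\<^sup>2
      + (v1 t)\<^sup>2 * cosh (u t) * sinh (u t) * u1 t - u1 t * u2 t) / w t) (at t within {a..b})"
    if t: "t \<in> {a..b}" for t
  proof -
    have "((\<lambda>t. \<epsilon> * metric_yz (u t) (u1 t) (v1 t)) has_real_derivative
        2 * (\<epsilon> * (v1 t * v2 t * (cosh (u t))\<^sup>2
      + (v1 t)\<^sup>2 * cosh (u t) * sinh (u t) * u1 t - u1 t * u2 t))) (at t within {a..b})"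
      unfolding metric_yz_def
      by (rule derivative_eq_intros du[OF t] dv[OF t] du1[OF t] dv1[OF t] refl)+
        (simp add: algebra_simps)
    from has_real_derivative_sqrt_half[OF this mpos0[OF t]]
    show ?thesis unfolding w_def .
  qed
  \<comment> \<open>In the doubly indexed family \<open>DU 1 1\<close> is both the
    \<open>s\<close>-derivative of the velocity and the \<open>t\<close>-derivative of the variation
    field: the symmetry of mixed partials.\<close>
  have dp: "(p has_real_derivative DU 1 1 0 t) (at t within {a..b})"
    and dq: "(q has_real_derivative DV 1 1 0 t) (at t within {a..b})" if "t \<in> {a..b}" for t
    using has_field_derivative_transform_on[OF DU(4)[OF S0 that, of 1 0] that, of p]
      has_field_derivative_transform_on[OF DV(4)[OF S0 that, of 1 0] that, of q] pq by auto
  have dB: "(B has_real_derivative Ls 0 t - G t) (at t within {a..b})" if t: "t \<in> {a..b}" for t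
  proof -
    have w0: "w t \<noteq> 0" "(w t)\<^sup>2 = \<epsilon> * metric_yz (u t) (u1 t) (v1 t)"
      using mpos0[OF t] by (auto simp: w_def)
    let ?F = "cosh (u t) * sin (v t) - sinh (u t) + lam"
    let ?M = "v1 t * (cosh (u t))\<^sup>2 * q t - u1 t * p t"
    let ?F1 = "(sinh (u t) * sin (v t) - cosh (u t)) * u1 t + cosh (u t) * cos (v t) * v1 t"
    let ?M1 = "v2 t * (cosh (u t))\<^sup>2 * q t + 2 * v1 t * cosh (u t) * sinh (u t) * u1 t * q t
      + v1 t * (cosh (u t))\<^sup>2 * DV 1 1 0 t - u2 t * p t - u1 t * DU 1 1 0 t"
    let ?w1 = "\<epsilon> * (v1 t * v2 t * (cosh (u t))\<^sup>2
      + (v1 t)\<^sup>2 * cosh (u t) * sinh (u t) * u1 t - u1 t * u2 t) / w t"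
    have dF: "((\<lambda>t. cosh (u t) * sin (v t) - sinh (u t) + lam) has_real_derivative ?F1)
        (at t within {a..b})"
      by (rule derivative_eq_intros du[OF t] dv[OF t] refl)+ (simp add: algebra_simps)
    have dM: "((\<lambda>t. v1 t * (cosh (u t))\<^sup>2 * q t - u1 t * p t) has_real_derivative ?M1)
        (at t within {a..b})"
      by (rule derivative_eq_intros du[OF t] dv[OF t] du1[OF t] dv1[OF t] dp[OF t] dq[OF t] refl)+
        (simp add: algebra_simps)
    have "(B has_real_derivative \<epsilon> * ((?F1 * ?M + ?F * ?M1) / w t - ?F * ?M * ?w1 / (w t)\<^sup>2))
        (at t within {a..b})"
      unfolding B_def
      by (rule DERIV_cmult[OF has_real_derivative_mult_divide[OF dF dM dw[OF t] w0(1)]])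
    moreover have "Ls 0 t = \<epsilon> * ((?F1 * ?M + ?F * ?M1) / w t - ?F * ?M * ?w1 / (w t)\<^sup>2) + G t"
      using lagrangian_variation_identity[OF w0 eps[OF S0 t], of "v t" "p t" "q t" lam
          "DV 1 1 0 t" "DU 1 1 0 t" "v2 t" "u2 t"] t
      by (simp add: Ls_def G_def D00 D01[unfolded One_nat_def] pq[unfolded One_nat_def] flip: w_def wm)
    ultimately show ?thesis by simp
  qed
  have "((\<lambda>t. Ls 0 t - G t) has_integral B b - B a) {a..b}"
    using ab dB by (intro fundamental_theorem_of_calculus)
      (auto simp: has_real_derivative_iff_has_vector_derivative)
  moreover have "B a = 0" "B b = 0" by (auto simp: B_def ends)
  moreover have "(Ls 0 has_integral integral {a..b} (Ls 0)) {a..b}"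
    using continuous_on_compose2[OF contLs, of "{a..b}" "\<lambda>t. (0, t)"] S0
    by (intro integrable_integral integrable_continuous_real) (auto simp: continuous_on_Pair_right image_subset_iff)
  \<comment> \<open>\<open>G\<close> is \<open>Ls 0\<close> minus the derivative of
    \<open>B\<close>, which integrates to \<open>B b - B a = 0\<close>.\<close>
  ultimately have "(G has_integral integral {a..b} (Ls 0)) {a..b}"
    using has_integral_diff[of "Ls 0" "integral {a..b} (Ls 0)" "{a..b}" "\<lambda>t. Ls 0 t - G t" 0] by simp
  with dE show ?thesis by blast
qed

section \<open>Existence of variations\<close>

text \<open>The minimum of \<open>m 0\<close> over the compact interval is positive, and compactness
  makes \<open>m s\<close> uniformly close to \<open>m 0\<close> for small \<open>s\<close>.\<close>

lemma compact_parameter_positive: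
  fixes m :: "real \<Rightarrow> real \<Rightarrow> real"
  assumes cont: "continuous_on (UNIV \<times> {a..b}) (\<lambda>(s, t). m s t)"
    and pos: "\<And>t. t \<in> {a..b} \<Longrightarrow> m 0 t > 0"
  obtains \<delta> where "\<delta> > 0" "\<And>s t. \<bar>s\<bar> < \<delta> \<Longrightarrow> t \<in> {a..b} \<Longrightarrow> m s t > 0"
proof (cases "{a..b} = {}")
  case True
  with that[of 1] show ?thesis by auto
next
  case False
  have "continuous_on {a..b} (m 0)"
    using continuous_on_compose2[OF cont, of "{a..b}" "\<lambda>t. (0, t)"] by (auto simp: continuous_on_Pair_right image_subset_iff)
  from continuous_attains_inf[OF compact_Icc False this]
  obtain t0 where t0: "t0 \<in> {a..b}" "\<And>t. t \<in> {a..b} \<Longrightarrow> m 0 t0 \<le> m 0 t" by blast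
  \<comment> \<open>Half the minimum: a change of at most \<open>e\<close> still leaves a value of
    at least \<open>e\<close>.\<close>
  define e where "e = m 0 t0 / 2"
  have e: "e > 0" using pos t0(1) by (simp add: e_def)
  obtain X where X: "0 \<in> X" "open X" "\<forall>s\<in>X \<inter> UNIV. \<forall>t\<in>{a..b}. dist (m s t) (m 0 t) \<le> e"
    by (rule continuous_on_prod_compactE[OF cont compact_Icc UNIV_I e]) (use that in auto)
  obtain \<delta> where \<delta>: "\<delta> > 0" "ball 0 \<delta> \<subseteq> X" using X open_contains_ball by blast
  show ?thesis
  proof (rule that[OF \<delta>(1)])
    fix s t assume s: "\<bar>s\<bar> < \<delta>" and t: "t \<in> {a..b}"
    then have "s \<in> X" using \<delta>(2) by (auto simp: dist_real_def)
    then have "dist (m s t) (m 0 t) \<le> e" using X(3) t by auto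
    then show "m s t > 0" using t0(2)[OF t] e unfolding dist_real_def e_def by arith
  qed
qed

lemma curve_in_de_sitter_yz_pos_iff:
  "curve u v t \<in> de_sitter_yz_pos \<longleftrightarrow> cosh (u t) * sin (v t) - sinh (u t) > 0"
  using Psi_in_de_sitter by (simp add: de_sitter_yz_pos_def curve_def) (simp add: Psi_def vector_3)

text \<open>Causal character and the side y > z are open conditions on \<gamma> and \<gamma>', so
  over the compact interval they persist for all small \<open>s\<close>; the zeros of
  \<open>p\<close> and \<open>q\<close> keep the end points fixed.\<close>

lemma (in chart_curve) admissible_linear_variation:
  assumes adm: "admissible_curve \<epsilon> a b u v"
    and p: "smooth_on_interval {a..b} p" "p a = 0" "p b = 0"
    and q: "smooth_on_interval {a..b} q" "q a = 0" "q b = 0"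
  obtains \<delta> where "admissible_variation \<epsilon> a b u v \<delta> (\<lambda>s t. u t + s * p t) (\<lambda>s t. v t + s * q t)"
proof -
  have su: "smooth_on_interval {a..b} u" and sv: "smooth_on_interval {a..b} v"
    using adm by (auto simp: admissible_curve_def)
  obtain p1 where p1: "\<And>t. t \<in> {a..b} \<Longrightarrow> (p has_real_derivative p1 t) (at t within {a..b})"
    and sp1: "smooth_on_interval {a..b} p1" using smooth_on_intervalE[OF p(1)] by blast
  obtain p2 where p2: "\<And>t. t \<in> {a..b} \<Longrightarrow> (p1 has_real_derivative p2 t) (at t within {a..b})"
    using smooth_on_intervalE[OF sp1] by blast
  obtain q1 where q1: "\<And>t. t \<in> {a..b} \<Longrightarrow> (q has_real_derivative q1 t) (at t within {a..b})"
    and sq1: "smooth_on_interval {a..b} q1" using smooth_on_intervalE[OF q(1)] by blast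
  obtain q2 where q2: "\<And>t. t \<in> {a..b} \<Longrightarrow> (q1 has_real_derivative q2 t) (at t within {a..b})"
    using smooth_on_intervalE[OF sq1] by blast
  have cs: "chart_curve a b (\<lambda>t. u t + s * p t) (\<lambda>t. v t + s * q t) (\<lambda>t. u1 t + s * p1 t)
      (\<lambda>t. v1 t + s * q1 t) (\<lambda>t. u2 t + s * p2 t) (\<lambda>t. v2 t + s * q2 t)" for s
    using ab du dv du1 dv1 p1 p2 q1 q2
    by unfold_locales (auto intro!: derivative_eq_intros)
  have c: "continuous_on {a..b} u" "continuous_on {a..b} v" "continuous_on {a..b} u1"
    "continuous_on {a..b} v1" "continuous_on {a..b} p" "continuous_on {a..b} q"
    "continuous_on {a..b} p1" "continuous_on {a..b} q1"
    using du dv du1 dv1 p1 q1 p2 q2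
    by (metis DERIV_continuous continuous_on_eq_continuous_within)+
  note c2 = c[THEN continuous_on_compose2[where s = "UNIV \<times> {a..b}" and f = snd,
        OF _ continuous_on_snd[OF continuous_on_id]]]
  have eps: "\<epsilon> = 1 \<or> \<epsilon> = - 1"
    and m0: "\<And>t. t \<in> {a..b} \<Longrightarrow> \<epsilon> * metric_yz (u t) (u1 t) (v1 t) > 0"
    using adm nondegenerate_curve_iff by (auto simp: admissible_curve_def)
  obtain \<delta>1 where d1: "\<delta>1 > 0" "\<And>s t. \<bar>s\<bar> < \<delta>1 \<Longrightarrow> t \<in> {a..b} \<Longrightarrow>
      \<epsilon> * metric_yz (u t + s * p t) (u1 t + s * p1 t) (v1 t + s * q1 t) > 0"
  proof (rule compact_parameter_positive)
    show "continuous_on (UNIV \<times> {a..b}) (\<lambda>(s, t).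
        \<epsilon> * metric_yz (u t + s * p t) (u1 t + s * p1 t) (v1 t + s * q1 t))"
      unfolding case_prod_beta metric_yz_def by (intro continuous_intros c2) auto
  qed (use m0 in auto)
  obtain \<delta>2 where d2: "\<delta>2 > 0" "\<And>s t. \<bar>s\<bar> < \<delta>2 \<Longrightarrow> t \<in> {a..b} \<Longrightarrow>
      cosh (u t + s * p t) * sin (v t + s * q t) - sinh (u t + s * p t) > 0"
  proof (rule compact_parameter_positive)
    show "continuous_on (UNIV \<times> {a..b}) (\<lambda>(s, t).
        cosh (u t + s * p t) * sin (v t + s * q t) - sinh (u t + s * p t))"
      unfolding case_prod_beta by (intro continuous_intros c2) auto
  qed (use adm in \<open>auto simp: admissible_curve_def image_subset_iff curve_in_de_sitter_yz_pos_iff\<close>)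
  define \<delta> where "\<delta> = min \<delta>1 \<delta>2"
  have "admissible_curve \<epsilon> a b (\<lambda>t. u t + s * p t) (\<lambda>t. v t + s * q t)" if "s \<in> {-\<delta><..<\<delta>}" for s
  proof -
    have s: "\<bar>s\<bar> < \<delta>1" "\<bar>s\<bar> < \<delta>2" using that by (auto simp: \<delta>_def)
    then show ?thesis
      unfolding admissible_curve_def chart_curve.nondegenerate_curve_iff[OF cs]
      using d1(2)[OF s(1)] d2(2)[OF s(2)] eps
      by (auto simp: curve_in_de_sitter_yz_pos_iff intro!: smooth_on_interval_intros su sv p q)
  qed
  then have "admissible_variation \<epsilon> a b u v \<delta> (\<lambda>s t. u t + s * p t) (\<lambda>s t. v t + s * q t)"
    unfolding admissible_variation_def
    using d1(1) d2(1) p q su sv by (auto simp: \<delta>_def intro: smooth_on_strip_linear)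
  then show ?thesis by (rule that)
qed

section \<open>The equivalence of the catenary and curvature conditions\<close>

lemma nonneg_has_integral_zero_imp_zero:
  fixes f :: "real \<Rightarrow> real"
  assumes "a < b" "continuous_on {a..b} f" "(f has_integral 0) {a..b}"
    and "\<And>t. t \<in> {a..b} \<Longrightarrow> f t \<ge> 0" and "t \<in> {a..b}"
  shows "f t = 0"
  using has_integral_0_cbox_imp_0[of a b f t] assms by auto

theorem theorem4p2:
  fixes \<epsilon> lam a b :: real and u v :: "real \<Rightarrow> real"
  assumes "a < b"
    and "smooth_on_interval {a..b} u" and "smooth_on_interval {a..b} v"
    and "nondegenerate \<epsilon> {a..b} (curve u v)"
    and "\<forall>t\<in>{a..b}. curve u v t \<in> de_sitter_yz_pos"
    and "\<forall>t\<in>{a..b}. dist_yz (curve u v t) + lam \<noteq> 0"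
  shows "catenary_yz \<epsilon> lam a b u v \<longleftrightarrow>
    (\<forall>t\<in>{a..b}. curvature \<epsilon> {a..b} (curve u v) t =
       - lprod (principal_normal \<epsilon> {a..b} (curve u v) t) T_yz / (dist_yz (curve u v t) + lam))"
proof -
  obtain u1 where u1: "\<And>t. t \<in> {a..b} \<Longrightarrow> (u has_real_derivative u1 t) (at t within {a..b})"
    and su1: "smooth_on_interval {a..b} u1" using smooth_on_intervalE[OF assms(2)] by blast
  obtain u2 where u2: "\<And>t. t \<in> {a..b} \<Longrightarrow> (u1 has_real_derivative u2 t) (at t within {a..b})"
    and su2: "smooth_on_interval {a..b} u2" using smooth_on_intervalE[OF su1] by blast
  obtain v1 where v1: "\<And>t. t \<in> {a..b} \<Longrightarrow> (v has_real_derivative v1 t) (at t within {a..b})"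
    and sv1: "smooth_on_interval {a..b} v1" using smooth_on_intervalE[OF assms(3)] by blast
  obtain v2 where v2: "\<And>t. t \<in> {a..b} \<Longrightarrow> (v1 has_real_derivative v2 t) (at t within {a..b})"
    and sv2: "smooth_on_interval {a..b} v2" using smooth_on_intervalE[OF sv1] by blast
  interpret chart_curve a b u v u1 v1 u2 v2
    using assms(1) u1 u2 v1 v2 by unfold_locales
  have adm: "admissible_curve \<epsilon> a b u v"
    using assms by (auto simp: admissible_curve_def)
  define k where "k t = euler_lagrange_yz lam (u t) (v t) (u1 t) (v1 t) (u2 t) (v2 t)" for t
  define w where "w t = sqrt (\<epsilon> * metric_yz (u t) (u1 t) (v1 t))" for t
  have m: "\<epsilon> * metric_yz (u t) (u1 t) (v1 t) > 0" if "t \<in> {a..b}" for t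
    using assms(4) that by (simp add: nondegenerate_curve_iff)
  have sk: "smooth_on_interval {a..b} k"
    unfolding k_def euler_lagrange_yz_def normal_yz_def metric_yz_def det_yz_def
    by (intro smooth_on_interval_intros smooth_on_interval_minus smooth_on_interval_diff
        smooth_on_interval_power assms su1 sv1 su2 sv2)
  have "catenary_yz \<epsilon> lam a b u v \<longleftrightarrow> (\<forall>t\<in>{a..b}. k t = 0)"
  proof
    assume k0: "\<forall>t\<in>{a..b}. k t = 0"
    have "((\<lambda>s. energy_yz \<epsilon> lam a b (U s) (V s)) has_real_derivative 0) (at 0)"
      if var: "admissible_variation \<epsilon> a b u v \<delta> U V" for \<delta> U V
    proof -
      have 0: "0 \<in> {-\<delta><..<\<delta>}" using var by (auto simp: admissible_variation_def)
      have diff: "\<exists>p. \<forall>t\<in>{a..b}. ((\<lambda>s. F s t) has_real_derivative p t) (at 0)"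
        if "smooth_on_strip {-\<delta><..<\<delta>} {a..b} F" for F
      proof -
        from that obtain D where D: "\<And>s t. s \<in> {-\<delta><..<\<delta>} \<Longrightarrow> t \<in> {a..b} \<Longrightarrow> D 0 0 s t = F s t"
          "\<And>i j s t. s \<in> {-\<delta><..<\<delta>} \<Longrightarrow> t \<in> {a..b} \<Longrightarrow>
            ((\<lambda>s'. D i j s' t) has_real_derivative D (Suc i) j s t) (at s within {-\<delta><..<\<delta>})"
          by (rule smooth_on_stripE) (rule that)
        have "((\<lambda>s. F s t) has_real_derivative D 1 0 0 t) (at 0)" if "t \<in> {a..b}" for t
          using has_field_derivative_transform_on[OF D(2)[OF 0 that, of 0 0] 0, of "\<lambda>s. F s t"] D(1) that
          by (simp add: at_within_open[OF 0 open_greaterThanLessThan])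
        then show ?thesis by (intro exI[of _ "D 1 0 0"]) blast
      qed
      obtain p q where pq: "\<And>t. t \<in> {a..b} \<Longrightarrow> ((\<lambda>s. U s t) has_real_derivative p t) (at 0)"
        "\<And>t. t \<in> {a..b} \<Longrightarrow> ((\<lambda>s. V s t) has_real_derivative q t) (at 0)"
        using diff[of U] diff[of V] var unfolding admissible_variation_def by blast
      obtain E where E: "((\<lambda>s. energy_yz \<epsilon> lam a b (U s) (V s)) has_real_derivative E) (at 0)"
        "((\<lambda>t. k t * cosh (u t) * (u1 t * q t - v1 t * p t) / w t ^ 3) has_integral E) {a..b}"
        using energy_first_variation[OF var pq, of lam] unfolding k_def w_def by blast
      \<comment> \<open>The integrand contains the factor \<open>k\<close>, so it vanishes on the
        whole interval.\<close>
      have "E = 0"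
        by (rule has_integral_unique[OF E(2)]) (rule has_integral_is_0, use k0 in auto)
      with E(1) show ?thesis by simp
    qed
    then show "catenary_yz \<epsilon> lam a b u v"
      using adm by (auto simp: catenary_yz_def)
  next
    assume cat: "catenary_yz \<epsilon> lam a b u v"
    define h where "h t = (t - a) * (b - t) * k t" for t
    have sh: "smooth_on_interval {a..b} h"
      unfolding h_def by (intro smooth_on_interval_intros smooth_on_interval_diff sk)
    define p where "p t = - (v1 t * h t)" for t
    define q where "q t = u1 t * h t" for t
    have sp: "smooth_on_interval {a..b} p" and sq: "smooth_on_interval {a..b} q"
      unfolding p_def q_def by (intro smooth_on_interval_intros smooth_on_interval_minus sh su1 sv1)+
    obtain \<delta> where var:
      "admissible_variation \<epsilon> a b u v \<delta> (\<lambda>s t. u t + s * p t) (\<lambda>s t. v t + s * q t)"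
      by (rule admissible_linear_variation[OF adm sp _ _ sq]) (auto simp: p_def q_def h_def)
    have dp: "((\<lambda>s. u t + s * p t) has_real_derivative p t) (at 0)"
         "((\<lambda>s. v t + s * q t) has_real_derivative q t) (at 0)" for t
      by (auto intro!: derivative_eq_intros)
    obtain E where E: "((\<lambda>s. energy_yz \<epsilon> lam a b (\<lambda>t. u t + s * p t) (\<lambda>t. v t + s * q t))
        has_real_derivative E) (at 0)"
      and int: "((\<lambda>t. k t * cosh (u t) * (u1 t * q t - v1 t * p t) / w t ^ 3) has_integral E) {a..b}"
      using energy_first_variation[OF var dp, of lam] unfolding k_def w_def by blast
    have "E = 0"
      using E cat var DERIV_unique unfolding catenary_yz_def by blast
    \<comment> \<open>This choice of \<open>p\<close> and \<open>q\<close> turns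
      \<open>u1 * q - v1 * p\<close> into \<open>h * (u1\<^sup>2 + v1\<^sup>2)\<close>, and
      \<open>h\<close> supplies a second factor \<open>k\<close>, hence the square.\<close>
    let ?g = "\<lambda>t. (t - a) * (b - t) * (k t)\<^sup>2 * cosh (u t) * ((u1 t)\<^sup>2 + (v1 t)\<^sup>2) / w t ^ 3"
    have "(\<lambda>t. k t * cosh (u t) * (u1 t * q t - v1 t * p t) / w t ^ 3) = ?g"
      by (rule ext) (simp add: p_def q_def h_def power2_eq_square algebra_simps)
    with int \<open>E = 0\<close> have int: "(?g has_integral 0) {a..b}" by simp
    have w: "w t > 0" if "t \<in> {a..b}" for t using m[OF that] by (simp add: w_def)
    have ck: "continuous_on {a..b} k" and cu: "continuous_on {a..b} u" "continuous_on {a..b} v"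
      "continuous_on {a..b} u1" "continuous_on {a..b} v1"
      using sk assms(2,3) su1 sv1 by (auto intro: smooth_on_interval_continuous)
    have cg: "continuous_on {a..b} ?g"
      unfolding w_def metric_yz_def
      by (intro continuous_intros ck cu) (use w in \<open>force simp: w_def metric_yz_def\<close>)
    have "?g t \<ge> 0" if "t \<in> {a..b}" for t
      using that w[OF that] by (auto intro!: divide_nonneg_pos mult_nonneg_nonneg)
    then have g0: "?g t = 0" if "t \<in> {a..b}" for t
      using nonneg_has_integral_zero_imp_zero[OF assms(1) cg int _ that] by blast
    have inner: "k t = 0" if "t \<in> {a<..<b}" for t
    proof -
      have "t \<in> {a..b}" using that by auto
      \<comment> \<open>If both derivatives vanished, so would \<langle>\<gamma>',
        \<gamma>'\<rangle>, against non-degeneracy.\<close>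
      moreover have "(u1 t)\<^sup>2 + (v1 t)\<^sup>2 \<noteq> 0"
        using m[OF \<open>t \<in> {a..b}\<close>] by (auto simp: metric_yz_def sum_power2_eq_zero_iff)
      ultimately show ?thesis using g0[of t] w[of t] that by auto
    qed
    \<comment> \<open>The weight \<open>(t - a) * (b - t)\<close> is zero at the end points; there
      the claim comes from continuity of \<open>k\<close>.\<close>
    show "\<forall>t\<in>{a..b}. k t = 0"
      using continuous_constant_on_closure[of "{a<..<b}" k 0] ck inner assms(1) by simp
  qed
  also have "\<dots> \<longleftrightarrow> (\<forall>t\<in>{a..b}. curvature \<epsilon> {a..b} (curve u v) t =
       - lprod (principal_normal \<epsilon> {a..b} (curve u v) t) T_yz / (dist_yz (curve u v t) + lam))"
    using curvature_equation_iff[OF assms(4)] assms(6) unfolding k_def by blast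
  finally show ?thesis .
qed

end
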